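(* Let $m,n\ge 2$, let $A\in\mathbb{R}^{m\times n}$ preserve Chebyshev systems, and let $v,\tilde v\in\mathrm{Ch}_n$. Assume that $\mathcal{S}(v)=\mathcal{S}(\tilde v)$. Then $E(A,v)=E(A,\tilde v)$.
   Context: A vector is called Chebyshev if all of its components are non-zero; $\mathrm{Ch}_n$ is the set of Chebyshev vectors in $\mathbb{R}^n$. For $v\in\mathrm{Ch}_n$, $\mathcal{S}(v)\in\{-1,1\}^n$ is the vector of signs, $\mathcal{S}(v)_i=\operatorname{sign}(v_i)$. $\|X\|_C=\max_{i,j}|x_{ij}|$ is the Chebyshev norm of a matrix $X$. For $a\in\mathbb{R}^n$ and $v\in\mathrm{Ch}_n$ (any $n\ge 2$), $\mu(a,v)$ is the unique real number with $\|a-\mu(a,v)v\|_\infty=\inf_{t\in\mathbb{R}}\|a-tv\|_\infty$ (it exists and is unique). Denote by $a^i$ the $i$-th row and by $a_j$ the $j$-th column of $A$. For $v\in\mathrm{Ch}_n$, $\phi(A,v)\in\mathbb{R}^m$ is defined by $\phi(A,v)_i=\mu(a^i,v)$; for $u\in\mathrm{Ch}_m$, $\psi(A,u)\in\mathbb{R}^n$ is defined by $\psi(A,u)_j=\mu(a_j,u)$. $A\in\mathbb{R}^{m\times n}$ preserves Chebyshev systems if $\phi(A,v)\in\mathrm{Ch}_m$ for all $v\in\mathrm{Ch}_n$ and $\psi(A,u)\in\mathrm{Ch}_n$ for all $u\in\mathrm{Ch}_m$. For such $A$ and $v^{(0)}\in\mathrm{Ch}_n$ the alternating minimization method produces the sequences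 $u^{(k)}=\phi(A,v^{(k-1)})$, $v^{(k)}=\psi(A,u^{(k)})$, $k=1,2,\dots$. The sequence $\|A-u^{(k)}(v^{(k)})^T\|_C$ is non-increasing, and $E(A,v)$ denotes its limit when $v^{(0)}=v$. *)

theory Defs
  imports "HOL-Analysis.Analysis"
begin

definition Ch :: "(real ^ 'n) set" where
  "Ch = {v. \<forall>i. v $ i \<noteq> 0}"

definition sign_vec :: "real ^ 'n \<Rightarrow> real ^ 'n" where
  "sign_vec v = (\<chi> i. sgn (v $ i))"

definition cheb_norm :: "real ^ 'n ^ 'm \<Rightarrow> real" where
  "cheb_norm X = Max {\<bar>X $ i $ j\<bar> | i j. True}"

definition outer :: "real ^ 'm \<Rightarrow> real ^ 'n \<Rightarrow> real ^ 'n ^ 'm" where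
  "outer u v = (\<chi> i j. u $ i * v $ j)"

(* Meaningful only for v in Ch, where the minimizer exists and is unique. *)
definition mu :: "real ^ 'n \<Rightarrow> real ^ 'n \<Rightarrow> real" where
  "mu a v = (THE s. infnorm (a - s *\<^sub>R v) = (INF t. infnorm (a - t *\<^sub>R v)))"

definition phi :: "real ^ 'n ^ 'm \<Rightarrow> real ^ 'n \<Rightarrow> real ^ 'm" where
  "phi A v = (\<chi> i. mu (row i A) v)"

definition psi :: "real ^ 'n ^ 'm \<Rightarrow> real ^ 'm \<Rightarrow> real ^ 'n" where
  "psi A u = (\<chi> j. mu (column j A) u)"

definition preserves_chebyshev :: "real ^ 'n ^ 'm \<Rightarrow> bool" where
  "preserves_chebyshev A \<longleftrightarrow> (\<forall>v\<in>Ch. phi A v \<in> Ch) \<and> (\<forall>u\<in>Ch. psi A u \<in> Ch)"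

primrec am_v :: "real ^ 'n ^ 'm \<Rightarrow> real ^ 'n \<Rightarrow> nat \<Rightarrow> real ^ 'n" where
  "am_v A v0 0 = v0"
| "am_v A v0 (Suc k) = psi A (phi A (am_v A v0 k))"

(* The sequence u starts at index 1; the value at index 0 is never used. *)
definition am_u :: "real ^ 'n ^ 'm \<Rightarrow> real ^ 'n \<Rightarrow> nat \<Rightarrow> real ^ 'm" where
  "am_u A v0 k = phi A (am_v A v0 (k - 1))"

definition am_limit :: "real ^ 'n ^ 'm \<Rightarrow> real ^ 'n \<Rightarrow> real" where
  "am_limit A v = lim (\<lambda>k. cheb_norm (A - outer (am_u A v (Suc k)) (am_v A v (Suc k))))"

end

theory Submission
  imports Defs
begin

text \<open>
  The limit \<^term>\<open>am_limit A v\<close> turns out to be a lower bound for the error of every rank one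
  matrix whose two factors have certain signs, namely signs that the iterates of \<open>v\<close> have infinitely
  often. The signs of the iterates depend only on those of \<open>v\<close>, so an orbit started at \<open>v'\<close> with the
  same signs produces such matrices again and again, and its limit cannot be smaller. Exchanging \<open>v\<close> and \<open>v'\<close>
  gives equality.

  Everything about one half step comes from equioscillation. Put \<open>s\<^sub>p = sgn v\<^sub>p\<close>. The residual of
  the best approximation to \<open>a\<close> on the line through \<open>v\<close>, with component \<open>p\<close> multiplied by
  \<open>s\<^sub>p\<close>, attains both its maximal modulus and the negative of it. This yields the closed formula
  \<open>\<mu>(a,v) = min\<^sub>q max\<^sub>p (s\<^sub>p a\<^sub>p + s\<^sub>q a\<^sub>q) / (\<bar>v\<^sub>p\<bar> + \<bar>v\<^sub>q\<bar>)\<close>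
  (lemma \<open>mu_minimax\<close>). Hence \<open>\<mu>\<close> is continuous on Chebyshev vectors, its sign depends only on
  the signs of \<open>v\<close>, and, when it is non-zero, \<open>\<bar>\<mu>(a,v)\<bar> \<parallel>v\<parallel>\<close> lies between two positive
  constants: the numerator takes only finitely many values, and the multiple \<open>0\<close> is not better than
  \<open>\<mu>\<close>. So the suitably rescaled iterates stay in
  a compact set of Chebyshev vectors (lemmas \<open>phi_bounds\<close> and \<open>compact_box_off_axes\<close>). They have a
  Chebyshev limit point \<open>l\<close>, and by continuity and scale invariance the error along the orbit of
  \<open>l\<close> is constantly the limit \<open>E\<close>.

  On an orbit of constant error \<open>E\<close>, consider the positions where the residual has modulus \<open>E\<close>.
  Rows and columns still carrying such a position after they have been optimized were not changed, by
  uniqueness of the minimizer; so the set of positions decreases and eventually stays constant. Then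
  each of its rows and columns equioscillates within the set. Such a pattern forbids an error below
  \<open>E\<close> for any pair of factors with the same signs: comparing ratios of components along the pattern
  would produce an endless increasing chain of indices (lemmas \<open>constant_error_lower_bound\<close> and
  \<open>alternance_lower_bound\<close>).
\<close>

section \<open>Best uniform approximation on a line\<close>

lemma sgn_mult_residual:
  fixes x s y :: real
  shows "sgn y * (x - s * y) = sgn y * x - s * \<bar>y\<bar>"
  by (simp add: algebra_simps abs_sgn)

text \<open>
  Only two indices can hold the best \<open>t\<close> in place, and for the two indices \<open>p\<close> and \<open>q\<close> alone the
  best error is \<open>\<bar>x p * w q - x q * w p\<bar> / (w p + w q)\<close>. So the pair with the largest such value is
  the decisive one: if another index violated its bound, exchanging it for \<open>p\<close> or \<open>q\<close> would give a
  pair with a larger value.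
\<close>

lemma exists_equioscillating:
  fixes x w :: "'n::finite \<Rightarrow> real"
  assumes w: "\<And>p. w p > 0"
  shows "\<exists>t p q e. x p - t * w p = e \<and> x q - t * w q = - e \<and> (\<forall>r. \<bar>x r - t * w r\<bar> \<le> e)"
proof -
  define g where "g = (\<lambda>(p, q). (x p * w q - x q * w p) / (w p + w q))"
  have "\<exists>z. \<forall>y. g y \<le> g z"
  proof -
    have "Max (range g) \<in> range g" by (intro Max_in) auto
    then obtain z where z: "Max (range g) = g z" by blast
    have "g y \<le> g z" for y unfolding z[symmetric] by (intro Max_ge) auto
    then show ?thesis by blast
  qed
  then obtain p q where pq: "\<And>r s. g (r, s) \<le> g (p, q)" by (metis prod.exhaust)
  define e where "e = g (p, q)"
  define t where "t = (x p + x q) / (w p + w q)"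
  have pos: "w r + w s > 0" for r s using w[of r] w[of s] by simp
  have ep: "x p - t * w p = e"
    using pos[of p q] by (simp add: e_def g_def t_def field_simps)
  have eq: "x q - t * w q = - e"
    using pos[of p q] by (simp add: e_def g_def t_def field_simps)
  have shift: "g (r, s) * (w r + w s) = (x r - t * w r) * w s - (x s - t * w s) * w r" for r s
    using pos[of r s] by (simp add: g_def field_simps)
  have up: "x r - t * w r \<le> e" for r
  proof (rule ccontr)
    assume "\<not> ?thesis"
    then have "e * w q < (x r - t * w r) * w q" using w[of q] by simp
    then have "e * (w r + w q) < g (r, q) * (w r + w q)"
      unfolding shift eq by (simp add: algebra_simps)
    then show False using pq[of r q] pos[of r q] by (simp add: e_def)
  qed
  have low: "- e \<le> x r - t * w r" for r
  proof (rule ccontr)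
    assume "\<not> ?thesis"
    then have "(x r - t * w r) * w p < (- e) * w p" using w[of p] by (intro mult_strict_right_mono) auto
    then have "e * (w p + w r) < g (p, r) * (w p + w r)"
      unfolding shift ep by (simp add: algebra_simps)
    then show False using pq[of p r] pos[of p r] by (simp add: e_def)
  qed
  have "\<forall>r. \<bar>x r - t * w r\<bar> \<le> e" using up low by (smt (verit))
  with ep eq show ?thesis by blast
qed

lemma infnorm_le_iff:
  fixes x :: "real ^ 'n"
  shows "infnorm x \<le> c \<longleftrightarrow> (\<forall>i. \<bar>x $ i\<bar> \<le> c)"
proof -
  have "{\<bar>x $ i\<bar> |i. i \<in> UNIV} = range (\<lambda>i. \<bar>x $ i\<bar>)" by auto
  then show ?thesis unfolding infnorm_cart
    by (subst cSup_le_iff) (auto simp: bdd_above_finite)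
qed

text \<open>
  Moving \<open>t\<close> to the right enlarges the residual at \<open>q\<close>, moving it to the left the one at \<open>p\<close>.
\<close>

lemma equioscillating_imp_mu:
  fixes a v :: "real ^ 'n"
  assumes "v \<in> Ch"
    and p: "sgn (v $ p) * (a $ p - t * v $ p) = e"
    and q: "sgn (v $ q) * (a $ q - t * v $ q) = - e"
    and le: "\<And>r. \<bar>a $ r - t * v $ r\<bar> \<le> e"
  shows "mu a v = t" and "\<And>s. (\<And>r. \<bar>a $ r - s * v $ r\<bar> \<le> e) \<Longrightarrow> s = t"
proof -
  have nz: "v $ r \<noteq> 0" for r using assms(1) by (auto simp: Ch_def)
  have strict: "\<exists>r. \<bar>a $ r - s * v $ r\<bar> > e" if "s \<noteq> t" for s
  proof (cases "s > t")
    case True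
    then have "s * \<bar>v $ q\<bar> > t * \<bar>v $ q\<bar>" using nz[of q] by simp
    then have "sgn (v $ q) * (a $ q - s * v $ q) < - e"
      using q unfolding sgn_mult_residual by simp
    moreover have "\<bar>sgn (v $ q) * (a $ q - s * v $ q)\<bar> = \<bar>a $ q - s * v $ q\<bar>"
      using nz[of q] by (simp add: abs_mult abs_sgn_eq)
    ultimately show ?thesis by (intro exI[of _ q]) linarith
  next
    case False
    with that have "s < t" by simp
    then have "s * \<bar>v $ p\<bar> < t * \<bar>v $ p\<bar>" using nz[of p] by simp
    then have "sgn (v $ p) * (a $ p - s * v $ p) > e"
      using p unfolding sgn_mult_residual by simp
    moreover have "\<bar>sgn (v $ p) * (a $ p - s * v $ p)\<bar> = \<bar>a $ p - s * v $ p\<bar>"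
      using nz[of p] by (simp add: abs_mult abs_sgn_eq)
    ultimately show ?thesis by (intro exI[of _ p]) linarith
  qed
  show "s = t" if "\<And>r. \<bar>a $ r - s * v $ r\<bar> \<le> e" for s
    using strict[of s] that by (meson not_le)
  have inft: "infnorm (a - t *\<^sub>R v) \<le> e"
    using le by (simp add: infnorm_le_iff)
  have gt: "infnorm (a - s *\<^sub>R v) > e" if "s \<noteq> t" for s
  proof -
    have "\<not> infnorm (a - s *\<^sub>R v) \<le> e"
      using strict[OF that] by (auto simp: infnorm_le_iff not_le)
    then show ?thesis by simp
  qed
  have bdd: "bdd_below (range (\<lambda>s. infnorm (a - s *\<^sub>R v)))"
    by (intro bdd_belowI[of _ 0]) (auto simp: infnorm_pos_le)
  have inf: "(INF s. infnorm (a - s *\<^sub>R v)) = infnorm (a - t *\<^sub>R v)"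
  proof (rule antisym)
    show "(INF s. infnorm (a - s *\<^sub>R v)) \<le> infnorm (a - t *\<^sub>R v)"
      by (rule cINF_lower[OF bdd]) simp
    show "infnorm (a - t *\<^sub>R v) \<le> (INF s. infnorm (a - s *\<^sub>R v))"
      by (rule cINF_greatest) (use inft gt in force)+
  qed
  show "mu a v = t"
    unfolding mu_def inf
    by (rule the_equality) (use inft gt in force)+
qed

text \<open>
  The last fact supplied is uniqueness of the minimizer: no other multiple of \<open>v\<close> comes within
  distance \<open>e\<close> of \<open>a\<close>.
\<close>

lemma mu_equioscillation:
  fixes a v :: "real ^ 'n"
  assumes "v \<in> Ch"
  obtains p q e where "sgn (v $ p) * (a $ p - mu a v * v $ p) = e"
    and "sgn (v $ q) * (a $ q - mu a v * v $ q) = - e"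
    and "\<And>r. \<bar>a $ r - mu a v * v $ r\<bar> \<le> e"
    and "\<And>s. (\<And>r. \<bar>a $ r - s * v $ r\<bar> \<le> e) \<Longrightarrow> s = mu a v"
proof -
  have nz: "v $ r \<noteq> 0" for r using assms(1) by (auto simp: Ch_def)
  then have "\<bar>v $ r\<bar> > 0" for r by simp
  from exists_equioscillating[of "\<lambda>r. \<bar>v $ r\<bar>" "\<lambda>r. sgn (v $ r) * a $ r", OF this]
  obtain t p q e where
    p: "sgn (v $ p) * (a $ p - t * v $ p) = e" and
    q: "sgn (v $ q) * (a $ q - t * v $ q) = - e" and
    le: "\<And>r. \<bar>sgn (v $ r) * (a $ r - t * v $ r)\<bar> \<le> e"
    unfolding sgn_mult_residual by blast
  have le': "\<bar>a $ r - t * v $ r\<bar> \<le> e" for r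
    using le[of r] nz[of r] by (simp add: abs_mult abs_sgn_eq)
  note eq = equioscillating_imp_mu[OF assms p q le']
  show ?thesis
    by (rule that[of p e q]) (use p q le' eq in auto)
qed

text \<open>
  Let \<open>P\<close> and \<open>Q\<close> be the indices where the signed residual is \<open>e\<close> and \<open>- e\<close>. Adding the residual at
  \<open>P\<close> to the one at any \<open>q\<close> gives a non-negative number, so the inner maximum is at least
  \<open>\<mu>\<close> for each \<open>q\<close>; adding the residual at \<open>Q\<close> to the one at any \<open>p\<close> gives a non-positive
  number, so the inner maximum is at most \<open>\<mu>\<close> for \<open>q = Q\<close>.
\<close>

lemma mu_minimax:
  fixes a v :: "real ^ 'n"
  assumes "v \<in> Ch"
  shows "mu a v = Min (range (\<lambda>q. Max (range (\<lambda>p.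
           (sgn (v $ p) * a $ p + sgn (v $ q) * a $ q) / (\<bar>v $ p\<bar> + \<bar>v $ q\<bar>)))))"
    (is "_ = Min (range (\<lambda>q. Max (range (\<lambda>p. ?g p q))))")
proof -
  obtain P Q e where P: "sgn (v $ P) * (a $ P - mu a v * v $ P) = e"
    and Q: "sgn (v $ Q) * (a $ Q - mu a v * v $ Q) = - e"
    and le: "\<And>r. \<bar>a $ r - mu a v * v $ r\<bar> \<le> e"
    using mu_equioscillation[OF assms] by metis
  have nz: "v $ r \<noteq> 0" for r using assms(1) by (auto simp: Ch_def)
  have pos: "\<bar>v $ r\<bar> + \<bar>v $ s\<bar> > 0" for r s using nz[of r] by simp
  have le': "\<bar>sgn (v $ r) * a $ r - mu a v * \<bar>v $ r\<bar>\<bar> \<le> e" for r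
    using le[of r] nz[of r] unfolding sgn_mult_residual[symmetric] by (simp add: abs_mult abs_sgn_eq)
  note PQ = P[unfolded sgn_mult_residual] Q[unfolded sgn_mult_residual]
  have ge: "mu a v \<le> Max (range (\<lambda>p. ?g p q))" for q
  proof -
    have "mu a v \<le> ?g P q"
      using pos[of P q] PQ(1) le'[of q] by (simp add: pos_le_divide_eq algebra_simps)
    also have "\<dots> \<le> Max (range (\<lambda>p. ?g p q))" by (intro Max_ge) auto
    finally show ?thesis .
  qed
  have "?g p Q \<le> mu a v" for p
    using pos[of p Q] PQ(2) le'[of p] by (simp add: pos_divide_le_eq algebra_simps)
  then have "Max (range (\<lambda>p. ?g p Q)) \<le> mu a v" by (subst Max_le_iff) auto
  with ge[of Q] have "mu a v = Max (range (\<lambda>p. ?g p Q))" by simp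
  then show ?thesis
    by (intro Min_eqI[symmetric]) (use ge in auto)
qed

lemma continuous_on_Max_range:
  fixes f :: "'i::finite \<Rightarrow> 'a::topological_space \<Rightarrow> real"
  assumes "\<And>i. continuous_on S (f i)"
  shows "continuous_on S (\<lambda>x. Max (range (\<lambda>i. f i x)))"
proof -
  have "continuous_on S (\<lambda>x. Max ((\<lambda>i. f i x) ` I))" if "finite I" "I \<noteq> {}" for I
    using that
    by (induction I rule: finite_ne_induct) (auto intro!: continuous_intros assms)
  then show ?thesis by simp
qed

lemma continuous_on_Min_range:
  fixes f :: "'i::finite \<Rightarrow> 'a::topological_space \<Rightarrow> real"
  assumes "\<And>i. continuous_on S (f i)"
  shows "continuous_on S (\<lambda>x. Min (range (\<lambda>i. f i x)))"
proof -
  have "continuous_on S (\<lambda>x. Min ((\<lambda>i. f i x) ` I))" if "finite I" "I \<noteq> {}" for I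
    using that
    by (induction I rule: finite_ne_induct) (auto intro!: continuous_intros assms)
  then show ?thesis by simp
qed

lemma continuous_on_mu: "continuous_on Ch (mu a)"
proof -
  have "continuous_on Ch (\<lambda>v. Min (range (\<lambda>q. Max (range (\<lambda>p.
           (sgn (v $ p) * a $ p + sgn (v $ q) * a $ q) / (\<bar>v $ p\<bar> + \<bar>v $ q\<bar>))))))"
    by (intro continuous_on_Min_range continuous_on_Max_range continuous_intros)
       (auto simp: Ch_def add_nonneg_eq_0_iff)
  then show ?thesis
    by (rule continuous_on_eq) (simp add: mu_minimax)
qed

text \<open>
  In the formula for \<open>\<mu>\<close> the denominators are positive and the numerators involve \<open>v\<close> only through
  its signs.
\<close>

lemma sgn_mu_cong:
  fixes a v v' :: "real ^ 'n"
  assumes "v \<in> Ch" "v' \<in> Ch" "sign_vec v = sign_vec v'"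
  shows "sgn (mu a v) = sgn (mu a v')"
proof -
  have s: "sgn (v $ i) = sgn (v' $ i)" for i
    using assms(3) by (simp add: sign_vec_def vec_eq_iff)
  have gt: "0 < mu a x \<longleftrightarrow> (\<forall>q. \<exists>p. 0 < sgn (x $ p) * a $ p + sgn (x $ q) * a $ q)"
    and lt: "mu a x < 0 \<longleftrightarrow> (\<exists>q. \<forall>p. sgn (x $ p) * a $ p + sgn (x $ q) * a $ q < 0)"
    if "x \<in> Ch" for x
  proof -
    have "x $ p \<noteq> 0" for p using that by (auto simp: Ch_def)
    then have pos: "\<bar>x $ p\<bar> + \<bar>x $ q\<bar> > 0" for p q by (simp add: add_pos_pos)
    show "0 < mu a x \<longleftrightarrow> (\<forall>q. \<exists>p. 0 < sgn (x $ p) * a $ p + sgn (x $ q) * a $ q)"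
      unfolding mu_minimax[OF that]
      by (subst Min_gr_iff; simp add: Max_gr_iff zero_less_divide_iff pos not_less[symmetric]
            less_not_sym[OF pos])
    show "mu a x < 0 \<longleftrightarrow> (\<exists>q. \<forall>p. sgn (x $ p) * a $ p + sgn (x $ q) * a $ q < 0)"
      unfolding mu_minimax[OF that]
      by (subst Min_less_iff; simp add: Max_less_iff divide_less_0_iff pos less_not_sym[OF pos])
  qed
  show ?thesis
    using gt[OF assms(1)] gt[OF assms(2)] lt[OF assms(1)] lt[OF assms(2)]
    unfolding s by (metis linorder_neqE sgn_0 sgn_neg sgn_pos)
qed

lemma mu_scale:
  fixes a v :: "real ^ 'n"
  assumes "v \<in> Ch" "c > 0"
  shows "mu a (c *\<^sub>R v) = mu a v / c"
proof -
  obtain p q e where "sgn (v $ p) * (a $ p - mu a v * v $ p) = e"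
    and "sgn (v $ q) * (a $ q - mu a v * v $ q) = - e"
    and "\<And>r. \<bar>a $ r - mu a v * v $ r\<bar> \<le> e"
    using mu_equioscillation[OF assms(1)] by metis
  with assms show ?thesis
    by (intro equioscillating_imp_mu(1)[where p = p and q = q and e = e]) (auto simp: Ch_def sgn_mult)
qed

text \<open>
  The multiple \<open>0\<close> already has error at most \<open>C\<close>, so the best multiple of \<open>v\<close> stays within
  \<open>C\<close> of a vector bounded by \<open>C\<close>.
\<close>

lemma mu_upper_bound:
  fixes a v :: "real ^ 'n"
  assumes "v \<in> Ch" "\<And>r. \<bar>a $ r\<bar> \<le> C"
  shows "\<bar>mu a v\<bar> * infnorm v \<le> 2 * C"
proof -
  obtain p q e where p: "sgn (v $ p) * (a $ p - mu a v * v $ p) = e"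
    and q: "sgn (v $ q) * (a $ q - mu a v * v $ q) = - e"
    and le: "\<And>r. \<bar>a $ r - mu a v * v $ r\<bar> \<le> e"
    and un: "\<And>s. (\<And>r. \<bar>a $ r - s * v $ r\<bar> \<le> e) \<Longrightarrow> s = mu a v"
    using mu_equioscillation[OF assms(1)] by metis
  have "C \<ge> 0" using assms(2) by (meson abs_ge_zero order_trans)
  show ?thesis
  proof (cases "e \<le> C")
    case True
    have "infnorm (mu a v *\<^sub>R v) \<le> 2 * C"
      unfolding infnorm_le_iff
    proof
      fix r show "\<bar>(mu a v *\<^sub>R v) $ r\<bar> \<le> 2 * C"
        using le[of r] assms(2)[of r] True by simp
    qed
    then show ?thesis by (simp add: infnorm_mul)
  next
    case False
    then have "\<bar>a $ r\<bar> \<le> e" for r using assms(2)[of r] by linarith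
    then have "0 = mu a v" by (intro un) simp
    with \<open>C \<ge> 0\<close> show ?thesis by simp
  qed
qed

text \<open>
  At the two equioscillation points the residuals cancel, so \<open>\<mu> (\<bar>v\<^sub>p\<bar> + \<bar>v\<^sub>q\<bar>)\<close> is a sum
  \<open>\<plusminus> a\<^sub>p \<plusminus> a\<^sub>q\<close>. The number \<open>d\<close> is a gap below the non-zero ones among these finitely many sums.
\<close>

lemma mu_lower_bound:
  fixes a v :: "real ^ 'n"
  assumes "v \<in> Ch" "mu a v \<noteq> 0"
    and d: "\<And>p q s s'. s \<in> {-1, 1} \<Longrightarrow> s' \<in> {-1, 1} \<Longrightarrow> s * a $ p + s' * a $ q \<noteq> 0 \<Longrightarrow>
              d \<le> \<bar>s * a $ p + s' * a $ q\<bar>"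
  shows "d \<le> 2 * (\<bar>mu a v\<bar> * infnorm v)"
proof -
  have nz: "v $ r \<noteq> 0" for r using assms(1) by (auto simp: Ch_def)
  obtain p q e where p: "sgn (v $ p) * (a $ p - mu a v * v $ p) = e"
    and q: "sgn (v $ q) * (a $ q - mu a v * v $ q) = - e"
    using mu_equioscillation[OF assms(1)] by metis
  have eq: "sgn (v $ p) * a $ p + sgn (v $ q) * a $ q = mu a v * (\<bar>v $ p\<bar> + \<bar>v $ q\<bar>)"
    using p q unfolding sgn_mult_residual by (simp add: algebra_simps)
  have "\<bar>v $ p\<bar> + \<bar>v $ q\<bar> > 0" using nz[of p] by simp
  with assms(2) have ne: "sgn (v $ p) * a $ p + sgn (v $ q) * a $ q \<noteq> 0" unfolding eq by simp
  have "d \<le> \<bar>sgn (v $ p) * a $ p + sgn (v $ q) * a $ q\<bar>"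
    by (rule d) (use ne nz in \<open>auto simp: sgn_if\<close>)
  also have "\<dots> = \<bar>mu a v\<bar> * (\<bar>v $ p\<bar> + \<bar>v $ q\<bar>)"
    unfolding eq by (simp add: abs_mult)
  also have "\<dots> \<le> \<bar>mu a v\<bar> * (infnorm v + infnorm v)"
    by (intro mult_left_mono add_mono) (use infnorm_le_iff[of v "infnorm v"] in auto)
  finally show ?thesis by simp
qed

section \<open>The two half steps of the iteration\<close>

text \<open>
  Through this identity every fact about rows carries over to columns.
\<close>

lemma psi_eq_phi_transpose: "psi A u = phi (transpose A) u"
  by (simp add: psi_def phi_def row_transpose)

lemma cheb_norm_eq_Max: "cheb_norm X = Max (range (\<lambda>(i, j). \<bar>X $ i $ j\<bar>))"
proof -
  have "{\<bar>X $ i $ j\<bar> | i j. True} = range (\<lambda>(i, j). \<bar>X $ i $ j\<bar>)" by auto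
  then show ?thesis by (simp add: cheb_norm_def)
qed

lemma cheb_norm_le_iff: "cheb_norm X \<le> c \<longleftrightarrow> (\<forall>i j. \<bar>X $ i $ j\<bar> \<le> c)"
  unfolding cheb_norm_eq_Max by (subst Max_le_iff) auto

lemma cheb_norm_nonneg: "0 \<le> cheb_norm X"
  using cheb_norm_le_iff[of X "cheb_norm X"] by (meson abs_ge_zero order_trans order_refl)

lemma cheb_norm_attained: "\<exists>i j. \<bar>X $ i $ j\<bar> = cheb_norm X"
proof -
  have "cheb_norm X \<in> range (\<lambda>(i, j). \<bar>X $ i $ j\<bar>)"
    unfolding cheb_norm_eq_Max by (intro Max_in) auto
  then show ?thesis by force
qed

lemma continuous_on_phi: "continuous_on Ch (phi A)"
  unfolding phi_def by (intro continuous_on_vec_lambda continuous_on_mu)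

lemma sign_vec_phi_cong:
  assumes "v \<in> Ch" "v' \<in> Ch" "sign_vec v = sign_vec v'"
  shows "sign_vec (phi A v) = sign_vec (phi A v')"
  using sgn_mu_cong[OF assms] by (simp add: sign_vec_def phi_def)

lemma phi_scale:
  assumes "v \<in> Ch" "c > 0"
  shows "phi A (c *\<^sub>R v) = inverse c *\<^sub>R phi A v"
  using assms by (simp add: phi_def vec_eq_iff mu_scale divide_inverse_commute)

lemma phi_equioscillation:
  fixes A :: "real ^ 'n ^ 'm"
  assumes "v \<in> Ch"
  obtains p q e where "sgn (v $ p) * (A $ i $ p - phi A v $ i * v $ p) = e"
    and "sgn (v $ q) * (A $ i $ q - phi A v $ i * v $ q) = - e"
    and "\<And>r. \<bar>A $ i $ r - phi A v $ i * v $ r\<bar> \<le> e"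
    and "\<And>s. (\<And>r. \<bar>A $ i $ r - s * v $ r\<bar> \<le> e) \<Longrightarrow> s = phi A v $ i"
  using mu_equioscillation[OF assms, of "row i A"] by (simp add: phi_def row_def) metis

lemma phi_optimal:
  fixes A :: "real ^ 'n ^ 'm"
  assumes "v \<in> Ch" "\<And>r. \<bar>A $ i $ r - s * v $ r\<bar> \<le> c"
  shows "\<bar>A $ i $ j - phi A v $ i * v $ j\<bar> \<le> c"
proof -
  obtain p q e where le: "\<And>r. \<bar>A $ i $ r - phi A v $ i * v $ r\<bar> \<le> e"
    and un: "\<And>s. (\<And>r. \<bar>A $ i $ r - s * v $ r\<bar> \<le> e) \<Longrightarrow> s = phi A v $ i"
    using phi_equioscillation[OF assms(1), of A i] by metis
  show ?thesis
  proof (cases "c \<le> e")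
    case True
    then have "s = phi A v $ i" by (meson assms(2) order_trans un)
    with assms(2) show ?thesis by simp
  next
    case False
    then show ?thesis using le[of j] by simp
  qed
qed

lemma cheb_norm_phi_le:
  assumes "v \<in> Ch"
  shows "cheb_norm (A - outer (phi A v) v) \<le> cheb_norm (A - outer u v)"
  unfolding cheb_norm_le_iff[of "A - outer (phi A v) v"]
proof (intro allI)
  fix i j
  have "\<bar>A $ i $ r - u $ i * v $ r\<bar> \<le> cheb_norm (A - outer u v)" for r
    using cheb_norm_le_iff[of "A - outer u v" "cheb_norm (A - outer u v)"]
    by (simp add: outer_def)
  from phi_optimal[OF assms this]
  show "\<bar>(A - outer (phi A v) v) $ i $ j\<bar> \<le> cheb_norm (A - outer u v)"
    by (simp add: outer_def)
qed

lemma cheb_norm_transpose_outer: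
  "cheb_norm (transpose A - outer v u) = cheb_norm (A - outer u v)"
  by (rule antisym)
    (use cheb_norm_le_iff[of "A - outer u v"] cheb_norm_le_iff[of "transpose A - outer v u"]
      in \<open>auto simp: outer_def transpose_def mult.commute\<close>)

lemma cheb_norm_psi_le:
  assumes "u \<in> Ch"
  shows "cheb_norm (A - outer u (psi A u)) \<le> cheb_norm (A - outer u v)"
  using cheb_norm_phi_le[OF assms, of "transpose A" v]
  by (simp add: psi_eq_phi_transpose cheb_norm_transpose_outer)

section \<open>Alternance bounds the error from below\<close>

lemma sgn_residual_eq:
  assumes "sgn (x::real) = sgn x'" "sgn y = sgn y'"
  shows "sgn x * sgn y * (c - x * y) - sgn x * sgn y * (c - x' * y') = \<bar>x'\<bar> * \<bar>y'\<bar> - \<bar>x\<bar> * \<bar>y\<bar>"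
proof -
  have "sgn x * sgn y * (x * y) = \<bar>x\<bar> * \<bar>y\<bar>" by (simp add: abs_sgn mult_ac)
  moreover have "sgn x * sgn y * (x' * y') = \<bar>x'\<bar> * \<bar>y'\<bar>"
    unfolding assms by (simp add: abs_sgn mult_ac)
  ultimately show ?thesis by (simp add: right_diff_distrib)
qed

text \<open>
  Suppose the pair \<open>u'\<close>, \<open>v'\<close> had an error below \<open>E\<close>. Where the signed residual of \<open>u\<close>, \<open>v\<close> is
  \<open>E\<close>, the product \<open>\<bar>u\<^sub>i v\<^sub>j\<bar>\<close> must be smaller than \<open>\<bar>u'\<^sub>i v'\<^sub>j\<bar>\<close>; where it is
  \<open>- E\<close>, it must be larger. In terms of the ratios \<open>\<rho>\<^sub>j = \<bar>v\<^sub>j / v'\<^sub>j\<bar>\<close> and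
  \<open>\<tau>\<^sub>i = \<bar>u'\<^sub>i / u\<^sub>i\<bar>\<close> this says \<open>\<rho>\<^sub>j < \<tau>\<^sub>i\<close> and \<open>\<tau>\<^sub>i < \<rho>\<^sub>j\<close> respectively. Going from a
  column to a row and from there to a column again strictly increases \<open>\<rho>\<close>, which is impossible from
  a column where \<open>\<rho>\<close> is maximal.
\<close>

lemma alternance_lower_bound:
  fixes A :: "real ^ 'n ^ 'm"
  assumes "u \<in> Ch" "v \<in> Ch" "u' \<in> Ch" "v' \<in> Ch"
    and su: "sign_vec u = sign_vec u'" and sv: "sign_vec v = sign_vec v'"
    and J: "J \<noteq> {}"
    and col: "\<And>j. j \<in> J \<Longrightarrow> \<exists>i\<in>I. sgn (u $ i) * sgn (v $ j) * (A $ i $ j - u $ i * v $ j) = E"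
    and row: "\<And>i. i \<in> I \<Longrightarrow> \<exists>j\<in>J. sgn (u $ i) * sgn (v $ j) * (A $ i $ j - u $ i * v $ j) = - E"
  shows "E \<le> cheb_norm (A - outer u' v')"
proof (rule ccontr)
  assume "\<not> ?thesis"
  then have less: "\<bar>A $ i $ j - u' $ i * v' $ j\<bar> < E" for i j
    using cheb_norm_le_iff[of "A - outer u' v'" "cheb_norm (A - outer u' v')"]
    by (simp add: outer_def not_le) (meson order.strict_trans1)
  have nz: "u $ i \<noteq> 0" "v $ j \<noteq> 0" "u' $ i \<noteq> 0" "v' $ j \<noteq> 0" for i j
    using assms(1-4) by (auto simp: Ch_def)
  have s: "sgn (u $ i) = sgn (u' $ i)" "sgn (v $ j) = sgn (v' $ j)" for i j
    using su sv by (auto simp: sign_vec_def vec_eq_iff)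
  define S where "S i j = sgn (u $ i) * sgn (v $ j)" for i j
  have less': "\<bar>S i j * (A $ i $ j - u' $ i * v' $ j)\<bar> < E" for i j
    using less[of i j] nz by (simp add: S_def abs_mult abs_sgn_eq)
  have diff: "S i j * (A $ i $ j - u $ i * v $ j) - S i j * (A $ i $ j - u' $ i * v' $ j) =
      \<bar>u' $ i\<bar> * \<bar>v' $ j\<bar> - \<bar>u $ i\<bar> * \<bar>v $ j\<bar>" for i j
    unfolding S_def by (rule sgn_residual_eq[OF s])
  define \<rho> where "\<rho> j = \<bar>v $ j\<bar> / \<bar>v' $ j\<bar>" for j
  define \<tau> where "\<tau> i = \<bar>u' $ i\<bar> / \<bar>u $ i\<bar>" for i
  have plus: "\<rho> j < \<tau> i" if "S i j * (A $ i $ j - u $ i * v $ j) = E" for i j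
  proof -
    have "\<bar>u $ i\<bar> * \<bar>v $ j\<bar> < \<bar>u' $ i\<bar> * \<bar>v' $ j\<bar>"
      using diff[of i j] less'[of i j] that by linarith
    then show ?thesis using nz(2,4)[of j] nz(1,3)[of i] by (simp add: \<rho>_def \<tau>_def divide_simps mult.commute)
  qed
  have minus: "\<tau> i < \<rho> j" if "S i j * (A $ i $ j - u $ i * v $ j) = - E" for i j
  proof -
    have "\<bar>u' $ i\<bar> * \<bar>v' $ j\<bar> < \<bar>u $ i\<bar> * \<bar>v $ j\<bar>"
      using diff[of i j] less'[of i j] that by linarith
    then show ?thesis using nz(2,4)[of j] nz(1,3)[of i] by (simp add: \<rho>_def \<tau>_def divide_simps mult.commute)
  qed
  have "Max (\<rho> ` J) \<in> \<rho> ` J" using J by (intro Max_in) auto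
  then obtain j where j: "j \<in> J" "Max (\<rho> ` J) = \<rho> j" by auto
  obtain i where i: "i \<in> I" "\<rho> j < \<tau> i" using col[OF j(1)] plus by (auto simp: S_def)
  obtain j' where j': "j' \<in> J" "\<tau> i < \<rho> j'" using row[OF i(1)] minus by (auto simp: S_def)
  have "\<rho> j' \<le> \<rho> j" unfolding j(2)[symmetric] using j'(1) by (intro Max_ge) auto
  with i(2) j'(2) show False by simp
qed


section \<open>Orbits of constant error\<close>

text \<open>
  If optimizing row \<open>i\<close> leaves an error of \<open>E\<close> although \<open>s\<close> had error at most \<open>E\<close>, then \<open>s\<close> was
  optimal already. This freezes the rows that keep an extremal position.
\<close>

lemma phi_unique:
  fixes A :: "real ^ 'n ^ 'm"
  assumes "v \<in> Ch" "\<And>r. \<bar>A $ i $ r - s * v $ r\<bar> \<le> E" "E \<le> \<bar>A $ i $ j - phi A v $ i * v $ j\<bar>"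
  shows "s = phi A v $ i"
proof -
  obtain p q e where le: "\<And>r. \<bar>A $ i $ r - phi A v $ i * v $ r\<bar> \<le> e"
    and un: "\<And>s. (\<And>r. \<bar>A $ i $ r - s * v $ r\<bar> \<le> e) \<Longrightarrow> s = phi A v $ i"
    using phi_equioscillation[OF assms(1), of A i] by metis
  show ?thesis
    by (rule un) (meson assms(2,3) le order_trans)
qed

lemma phi_alternance:
  fixes A :: "real ^ 'n ^ 'm"
  assumes "v \<in> Ch" "\<And>r. \<bar>A $ i $ r - phi A v $ i * v $ r\<bar> \<le> E"
    and "\<bar>A $ i $ j - phi A v $ i * v $ j\<bar> = E" and "s \<in> {-1, 1}"
  shows "\<exists>p. sgn (v $ p) * (A $ i $ p - phi A v $ i * v $ p) = s * E"
proof -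
  obtain p q e where p: "sgn (v $ p) * (A $ i $ p - phi A v $ i * v $ p) = e"
    and q: "sgn (v $ q) * (A $ i $ q - phi A v $ i * v $ q) = - e"
    and le: "\<And>r. \<bar>A $ i $ r - phi A v $ i * v $ r\<bar> \<le> e"
    using phi_equioscillation[OF assms(1), of A i] by metis
  have nz: "v $ p \<noteq> 0" using assms(1) by (auto simp: Ch_def)
  have "E \<le> e" using le[of j] assms(3) by simp
  have "\<bar>e\<bar> = \<bar>A $ i $ p - phi A v $ i * v $ p\<bar>"
    unfolding p[symmetric] using nz by (simp add: abs_mult abs_sgn_eq)
  with assms(2)[of p] \<open>E \<le> e\<close> have "e = E" by linarith
  with p q assms(4) show ?thesis by auto
qed

lemma psi_unique:
  fixes A :: "real ^ 'n ^ 'm"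
  assumes "u \<in> Ch" "\<And>r. \<bar>A $ r $ j - u $ r * s\<bar> \<le> E" "E \<le> \<bar>A $ i $ j - u $ i * psi A u $ j\<bar>"
  shows "s = psi A u $ j"
  using phi_unique[of u "transpose A" j s E i] assms
  by (simp add: psi_eq_phi_transpose transpose_def mult.commute)

lemma psi_alternance:
  fixes A :: "real ^ 'n ^ 'm"
  assumes "u \<in> Ch" "\<And>r. \<bar>A $ r $ j - u $ r * psi A u $ j\<bar> \<le> E"
    and "\<bar>A $ i $ j - u $ i * psi A u $ j\<bar> = E" and "s \<in> {-1, 1}"
  shows "\<exists>p. sgn (u $ p) * (A $ p $ j - u $ p * psi A u $ j) = s * E"
  using phi_alternance[of u "transpose A" j E i s] assms
  by (simp add: psi_eq_phi_transpose transpose_def mult.commute)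

text \<open>
  Equioscillation of a row or a column multiplies residuals by the sign of one factor only. These are the rules
  for passing to the product of the signs of both factors.
\<close>

lemma signed_residual:
  fixes a b c E :: real
  assumes "a \<noteq> 0" "b \<noteq> 0" "0 \<le> E"
  shows "sgn b * c = sgn a * E \<Longrightarrow> \<bar>c\<bar> = E"
    and "sgn b * c = sgn a * E \<Longrightarrow> sgn a * sgn b * c = E"
    and "sgn b * c = - sgn a * E \<Longrightarrow> \<bar>c\<bar> = E"
    and "sgn b * c = - sgn a * E \<Longrightarrow> sgn a * sgn b * c = - E"
  using assms by (auto simp: sgn_if split: if_splits)

text \<open>
  Since \<^const>\<open>am_limit\<close> skips the error of the initial vector, its terms are the errors after a full
  step, and each of them is a function of the preceding iterate alone.
\<close>

definition am_error :: "real ^ 'n ^ 'm \<Rightarrow> real ^ 'n \<Rightarrow> real" where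
  "am_error A v = cheb_norm (A - outer (phi A v) (psi A (phi A v)))"

lemma phi_Ch: "preserves_chebyshev A \<Longrightarrow> v \<in> Ch \<Longrightarrow> phi A v \<in> Ch"
  and psi_Ch: "preserves_chebyshev A \<Longrightarrow> u \<in> Ch \<Longrightarrow> psi A u \<in> Ch"
  by (auto simp: preserves_chebyshev_def)

lemma am_v_Ch: "preserves_chebyshev A \<Longrightarrow> v \<in> Ch \<Longrightarrow> am_v A v k \<in> Ch"
  by (induction k) (auto intro: phi_Ch psi_Ch)

lemma am_v_add: "am_v A (am_v A v k) l = am_v A v (k + l)"
  by (induction l) auto

text \<open>
  The set \<open>M N\<close> of extremal positions decreases with \<open>N\<close>, because a position that is extremal after
  a step lies in a row and a column that the step did not change. It is never empty, so at an \<open>N\<close> where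
  it has the fewest elements it is equal to \<open>M (Suc N)\<close>. There the columns equioscillate since
  \<open>V N\<close> is optimal for \<open>U N\<close>, and the rows in question do so too, since their entries in
  \<open>U N\<close> survive the next optimization. The conclusion is then the lower bound by alternance.
\<close>

lemma constant_error_lower_bound:
  fixes A :: "real ^ 'n ^ 'm"
  assumes A: "preserves_chebyshev A" and y: "y \<in> Ch"
    and E: "\<And>N. am_error A (am_v A y N) = E"
  shows "\<exists>N. \<forall>u'\<in>Ch. \<forall>v'\<in>Ch. sign_vec u' = sign_vec (phi A (am_v A y N)) \<longrightarrow>
           sign_vec v' = sign_vec (am_v A y (Suc N)) \<longrightarrow> E \<le> cheb_norm (A - outer u' v')"
proof -
  define U where "U N = phi A (am_v A y N)" for N
  define V where "V N = am_v A y (Suc N)" for N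
  have V: "V N = psi A (U N)" and U: "U (Suc N) = phi A (V N)" for N
    by (simp_all add: U_def V_def)
  have Ch: "U N \<in> Ch" "V N \<in> Ch" for N
    unfolding U_def V_def using A y by (blast intro: phi_Ch am_v_Ch)+
  have errE: "cheb_norm (A - outer (U N) (V N)) = E" for N
    using E[of N] by (simp add: am_error_def U_def V_def)
  have le: "\<bar>A $ i $ j - U N $ i * V N $ j\<bar> \<le> E" for N i j
    using cheb_norm_le_iff[of "A - outer (U N) (V N)" E] errE[of N] by (simp add: outer_def)
  have mid: "\<bar>A $ i $ j - U (Suc N) $ i * V N $ j\<bar> \<le> E" for N i j
    using cheb_norm_le_iff[of "A - outer (U (Suc N)) (V N)" E] errE[of N]
      cheb_norm_phi_le[OF Ch(2), of A N "U N"] by (simp add: outer_def U)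
  define M where "M N = {(i, j). \<bar>A $ i $ j - U N $ i * V N $ j\<bar> = E}" for N
  \<comment> \<open>The step is traced backwards, first through the optimization of the columns, then through that
      of the rows.\<close>
  have stable: "U (Suc N) $ i = U N $ i \<and> V (Suc N) $ j = V N $ j" if "(i, j) \<in> M (Suc N)" for N i j
  proof -
    have eq: "\<bar>A $ i $ j - U (Suc N) $ i * V (Suc N) $ j\<bar> = E"
      using that by (simp add: M_def)
    have v: "V N $ j = V (Suc N) $ j"
      unfolding V[of "Suc N"]
      by (rule psi_unique[OF Ch(1) mid, where i = i]) (simp only: eq V[symmetric])
    have "U N $ i = U (Suc N) $ i"
      unfolding U
      by (rule phi_unique[OF Ch(2) le, where j = j]) (simp only: eq v U[symmetric])
    with v show ?thesis by simp
  qed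
  have sub: "M (Suc N) \<subseteq> M N" for N
  proof
    fix x assume x: "x \<in> M (Suc N)"
    obtain i j where ij: "x = (i, j)" by (cases x)
    have st: "U (Suc N) $ i = U N $ i" "V (Suc N) $ j = V N $ j"
      using stable x unfolding ij by blast+
    have "\<bar>A $ i $ j - U (Suc N) $ i * V (Suc N) $ j\<bar> = E"
      using x unfolding ij M_def by blast
    then show "x \<in> M N"
      unfolding st unfolding ij M_def by blast
  qed
  have ne: "M N \<noteq> {}" for N
  proof -
    obtain i j where "\<bar>(A - outer (U N) (V N)) $ i $ j\<bar> = E"
      using cheb_norm_attained[of "A - outer (U N) (V N)"] unfolding errE by blast
    then have "(i, j) \<in> M N" by (simp add: M_def outer_def)
    then show ?thesis by blast
  qed
  define N where "N = (ARG_MIN (\<lambda>N. card (M N)) N. True)"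
  have "card (M N) \<le> card (M (Suc N))"
    unfolding N_def by (rule arg_min_nat_le) simp
  then have MS: "M (Suc N) = M N"
    by (intro card_seteq sub) auto
  have nz: "U N $ i \<noteq> 0" "V N $ j \<noteq> 0" for i j
    using Ch[of N] by (auto simp: Ch_def)
  have pm: "sgn (V N $ j) \<in> {-1, 1}" "- sgn (U N $ i) \<in> {-1, 1}" for i j
    using nz(1)[of i] nz(2)[of j] by (auto simp: sgn_if)
  have "0 \<le> E" using cheb_norm_nonneg[of "A - outer (U N) (V N)"] by (simp add: errE)
  have col: "\<exists>i\<in>fst ` M N. sgn (U N $ i) * sgn (V N $ j) * (A $ i $ j - U N $ i * V N $ j) = E"
    if "j \<in> snd ` M N" for j
  proof -
    from that obtain i where "(i, j) \<in> M N" by auto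
    then have "\<bar>A $ i $ j - U N $ i * V N $ j\<bar> = E"
      by (simp add: M_def)
    from psi_alternance[OF Ch(1)[of N] le[of _ _ N, unfolded V] this[unfolded V] pm(1)[of j]]
    obtain p where p: "sgn (U N $ p) * (A $ p $ j - U N $ p * V N $ j) = sgn (V N $ j) * E"
      by (auto simp: V)
    have "\<bar>A $ p $ j - U N $ p * V N $ j\<bar> = E"
      by (rule signed_residual(1)[OF nz(2) nz(1) \<open>0 \<le> E\<close> p])
    then have "(p, j) \<in> M N" by (simp add: M_def)
    moreover have "sgn (U N $ p) * sgn (V N $ j) * (A $ p $ j - U N $ p * V N $ j) = E"
      using signed_residual(2)[OF nz(2) nz(1) \<open>0 \<le> E\<close> p] by (simp only: mult.commute)
    ultimately show ?thesis by force
  qed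
  have row: "\<exists>j\<in>snd ` M N. sgn (U N $ i) * sgn (V N $ j) * (A $ i $ j - U N $ i * V N $ j) = - E"
    if "i \<in> fst ` M N" for i
  proof -
    from that obtain j where ij: "(i, j) \<in> M N" by auto
    then have eq: "\<bar>A $ i $ j - U N $ i * V N $ j\<bar> = E"
      by (simp add: M_def)
    have u: "U N $ i = phi A (V N) $ i" using ij MS stable[of i j N] by (simp add: U)
    from phi_alternance[OF Ch(2)[of N] le[of i _ N, unfolded u] eq[unfolded u] pm(2)[of i]]
    obtain p where p: "sgn (V N $ p) * (A $ i $ p - U N $ i * V N $ p) = - sgn (U N $ i) * E"
      by (auto simp: u)
    have "\<bar>A $ i $ p - U N $ i * V N $ p\<bar> = E"
      by (rule signed_residual(3)[OF nz(1) nz(2) \<open>0 \<le> E\<close> p])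
    then have "(i, p) \<in> M N" by (simp add: M_def)
    moreover have "sgn (U N $ i) * sgn (V N $ p) * (A $ i $ p - U N $ i * V N $ p) = - E"
      using signed_residual(4)[OF nz(1) nz(2) \<open>0 \<le> E\<close> p] .
    ultimately show ?thesis by force
  qed
  have "E \<le> cheb_norm (A - outer u' v')"
    if "u' \<in> Ch" "v' \<in> Ch" "sign_vec u' = sign_vec (U N)" "sign_vec v' = sign_vec (V N)" for u' v'
    by (rule alternance_lower_bound[OF Ch(1)[of N] Ch(2)[of N] that(1,2) that(3,4)[symmetric] _ col row])
       (use ne in auto)
  then show ?thesis unfolding U_def V_def by blast
qed

section \<open>Limit points of rescaled orbits\<close>

text \<open>
  Only finitely many numbers \<open>\<plusminus> A $ i $ p \<plusminus> A $ i $ q\<close> occur as numerators of \<open>\<mu>\<close>, so the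
  non-zero ones have a positive minimum modulus. The resulting bounds are uniform in \<open>v\<close>, however close
  \<open>v\<close> may be to a coordinate hyperplane.
\<close>

lemma phi_bounds:
  fixes A :: "real ^ 'n ^ 'm"
  shows "\<exists>d>0. \<exists>C. \<forall>v\<in>Ch. phi A v \<in> Ch \<longrightarrow>
           (\<forall>i. d \<le> \<bar>phi A v $ i\<bar> * infnorm v \<and> \<bar>phi A v $ i\<bar> * infnorm v \<le> C)"
proof -
  define D where "D = (\<lambda>(s, s', i, p, q). \<bar>s * A $ i $ p + s' * A $ i $ q\<bar>) `
    ({-1, 1} \<times> {-1, 1} \<times> UNIV \<times> UNIV \<times> UNIV) - {0}"
  define d where "d = Min (insert 1 D)"
  \<comment> \<open>The element 1 serves as the gap when all the sums vanish.\<close>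
  have fin: "finite (insert 1 D)" by (simp add: D_def)
  have "d \<in> insert 1 D" unfolding d_def by (rule Min_in[OF fin]) simp
  then have "d > 0" by (auto simp: D_def)
  have dle: "d \<le> \<bar>s * A $ i $ p + s' * A $ i $ q\<bar>"
    if "s \<in> {-1, 1}" "s' \<in> {-1, 1}" "s * A $ i $ p + s' * A $ i $ q \<noteq> 0" for s s' i p q
  proof -
    have "(s, s', i, p, q) \<in> {-1, 1} \<times> {-1, 1} \<times> UNIV \<times> UNIV \<times> UNIV" using that by simp
    then have "\<bar>s * A $ i $ p + s' * A $ i $ q\<bar> \<in> insert 1 D"
      using that(3) unfolding D_def
      by (intro insertI2 DiffI image_eqI[where x = "(s, s', i, p, q)"]) auto
    then show ?thesis unfolding d_def by (rule Min_le[OF fin])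
  qed
  have "d / 2 \<le> \<bar>phi A v $ i\<bar> * infnorm v" "\<bar>phi A v $ i\<bar> * infnorm v \<le> 2 * cheb_norm A"
    if "v \<in> Ch" "phi A v \<in> Ch" for v i
  proof -
    have ne: "mu (row i A) v \<noteq> 0" using that(2) by (auto simp: Ch_def phi_def)
    show "d / 2 \<le> \<bar>phi A v $ i\<bar> * infnorm v"
      using mu_lower_bound[OF that(1) ne, of d] dle by (auto simp: phi_def row_def)
    show "\<bar>phi A v $ i\<bar> * infnorm v \<le> 2 * cheb_norm A"
      using mu_upper_bound[OF that(1), of "row i A" "cheb_norm A"] cheb_norm_le_iff[of A "cheb_norm A"]
      by (auto simp: phi_def row_def)
  qed
  with \<open>d > 0\<close> show ?thesis
    by (intro exI[of _ "d / 2"] conjI exI[of _ "2 * cheb_norm A"] ballI impI allI) auto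
qed

lemma compact_box_off_axes:
  "compact {z :: real ^ 'n. \<forall>j. d \<le> \<bar>z $ j\<bar> \<and> \<bar>z $ j\<bar> \<le> C}"
proof -
  have "closed {z :: real ^ 'n. \<forall>j. d \<le> \<bar>z $ j\<bar> \<and> \<bar>z $ j\<bar> \<le> C}"
    by (intro closed_Collect_all closed_Collect_conj closed_Collect_le continuous_intros)
  moreover have "bounded {z :: real ^ 'n. \<forall>j. d \<le> \<bar>z $ j\<bar> \<and> \<bar>z $ j\<bar> \<le> C}"
    by (rule bounded_subset[OF bounded_cbox[of "\<chi> i. - C" "\<chi> i. C"]])
       (auto simp: mem_box_cart abs_le_iff minus_le_iff)
  ultimately show ?thesis by (simp add: compact_eq_bounded_closed)
qed

lemma eventually_sign_vec_eq:
  fixes l :: "real ^ 'n"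
  assumes "(f \<longlongrightarrow> l) F" "l \<in> Ch"
  shows "eventually (\<lambda>x. sign_vec (f x) = sign_vec l) F"
proof -
  have "eventually (\<lambda>x. sgn (f x $ i) = sgn (l $ i)) F" for i
  proof -
    have lim: "((\<lambda>x. f x $ i) \<longlongrightarrow> l $ i) F" by (intro tendsto_intros assms)
    from assms(2) have "l $ i > 0 \<or> l $ i < 0" by (auto simp: Ch_def neq_iff)
    then show ?thesis
    proof
      assume "l $ i > 0"
      then show ?thesis using order_tendstoD(1)[OF lim, of 0] by (auto elim!: eventually_mono)
    next
      assume "l $ i < 0"
      then show ?thesis using order_tendstoD(2)[OF lim, of 0] by (auto elim!: eventually_mono)
    qed
  qed
  then have "eventually (\<lambda>x. \<forall>i. sgn (f x $ i) = sgn (l $ i)) F"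
    by (rule eventually_all_finite)
  then show ?thesis by (simp add: sign_vec_def vec_eq_iff)
qed

lemma psi_scale: "u \<in> Ch \<Longrightarrow> c > 0 \<Longrightarrow> psi A (c *\<^sub>R u) = inverse c *\<^sub>R psi A u"
  by (simp add: psi_eq_phi_transpose phi_scale)

lemma am_v_scale:
  assumes "preserves_chebyshev A" "v \<in> Ch" "c > 0"
  shows "am_v A (c *\<^sub>R v) k = c *\<^sub>R am_v A v k"
proof (induction k)
  case (Suc k)
  have v: "am_v A v k \<in> Ch" using assms by (simp add: am_v_Ch)
  have "psi A (phi A (c *\<^sub>R am_v A v k)) = c *\<^sub>R psi A (phi A (am_v A v k))"
    using psi_scale[OF phi_Ch[OF assms(1) v], of "inverse c"] assms(3)
    by (simp add: phi_scale[OF v])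
  with Suc show ?case by simp
qed simp

lemma am_error_scale:
  assumes "preserves_chebyshev A" "v \<in> Ch" "c > 0"
  shows "am_error A (c *\<^sub>R v) = am_error A v"
proof -
  have "outer (phi A (c *\<^sub>R v)) (psi A (phi A (c *\<^sub>R v))) = outer (phi A v) (psi A (phi A v))"
    using am_v_scale[OF assms, of 1] assms(3)
    by (simp add: phi_scale[OF assms(2,3)] outer_def vec_eq_iff)
  then show ?thesis by (simp add: am_error_def)
qed

lemma sign_vec_am_v_cong:
  assumes "preserves_chebyshev A" "v \<in> Ch" "v' \<in> Ch" "sign_vec v = sign_vec v'"
  shows "sign_vec (am_v A v k) = sign_vec (am_v A v' k)"
proof (induction k)
  case (Suc k)
  then show ?case unfolding am_v.simps psi_eq_phi_transpose
    using assms by (intro sign_vec_phi_cong phi_Ch am_v_Ch)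
qed (simp add: assms)

lemma sign_vec_scale: "c > 0 \<Longrightarrow> sign_vec (c *\<^sub>R v) = sign_vec v"
  by (simp add: sign_vec_def sgn_mult)

lemma continuous_on_psi: "continuous_on Ch (psi A)"
  using continuous_on_phi[of "transpose A"] by (simp add: psi_eq_phi_transpose[abs_def])

lemma continuous_on_am_v:
  assumes "preserves_chebyshev A"
  shows "continuous_on Ch (\<lambda>v. am_v A v k)"
proof (induction k)
  case (Suc k)
  have "continuous_on Ch (\<lambda>v. phi A (am_v A v k))"
    by (rule continuous_on_compose2[OF continuous_on_phi Suc]) (use assms am_v_Ch in blast)
  then show ?case unfolding am_v.simps
    by (rule continuous_on_compose2[OF continuous_on_psi]) (use assms am_v_Ch phi_Ch in blast)
qed (simp add: continuous_on_id)

lemma continuous_on_am_error: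
  assumes "preserves_chebyshev A"
  shows "continuous_on Ch (am_error A)"
proof -
  have psi: "continuous_on Ch (\<lambda>v. psi A (phi A v))"
    using continuous_on_am_v[OF assms, of 1] by simp
  have "continuous_on Ch (\<lambda>v. Max (range (\<lambda>z. \<bar>A $ fst z $ snd z -
          phi A v $ fst z * psi A (phi A v) $ snd z\<bar>)))"
    by (intro continuous_on_Max_range continuous_intros psi continuous_on_phi)
  then show ?thesis
    by (simp add: am_error_def[abs_def] cheb_norm_eq_Max outer_def case_prod_beta')
qed

text \<open>
  Neither half step increases the error, because each of them optimizes one factor with the other one
  fixed.
\<close>

lemma am_error_LIMSEQ:
  assumes A: "preserves_chebyshev A" and v: "v \<in> Ch"
  shows "(\<lambda>k. am_error A (am_v A v k)) \<longlonglongrightarrow> am_limit A v"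
proof -
  have "am_error A (am_v A v (Suc k)) \<le> am_error A (am_v A v k)" for k
  proof -
    have w: "am_v A v (Suc k) \<in> Ch" using A v by (rule am_v_Ch)
    have "am_error A (am_v A v (Suc k)) \<le>
        cheb_norm (A - outer (phi A (am_v A v (Suc k))) (am_v A v (Suc k)))"
      unfolding am_error_def by (rule cheb_norm_psi_le[OF phi_Ch[OF A w]])
    also have "\<dots> \<le> am_error A (am_v A v k)"
      using cheb_norm_phi_le[OF w, of A "phi A (am_v A v k)"] by (simp add: am_error_def)
    finally show ?thesis .
  qed
  then have "decseq (\<lambda>k. am_error A (am_v A v k))" by (rule decseq_SucI)
  then have "convergent (\<lambda>k. am_error A (am_v A v k))"
    by (metis am_error_def cheb_norm_nonneg convergentI decseq_convergent)
  moreover have "am_limit A v = lim (\<lambda>k. am_error A (am_v A v k))"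
    by (simp add: am_limit_def am_error_def am_u_def)
  ultimately show ?thesis by (simp add: convergent_LIMSEQ_iff)
qed

text \<open>
  The iterates of \<open>v\<close>, rescaled by the norm of the preceding row factor, lie in a compact set of
  Chebyshev vectors. Along the orbit of a limit point \<open>l\<close> the error is constantly the limit for \<open>v\<close>,
  and this value is a lower bound for all factors with the signs of some iterate of \<open>l\<close>. Iterates of
  \<open>v\<close> close to \<open>l\<close> after rescaling have the signs of \<open>l\<close>; so do the iterates of \<open>v'\<close> with the
  same number, and the signs still agree \<open>N\<close> steps later. The bound therefore applies to infinitely many
  iterates of \<open>v'\<close>.
\<close>

lemma am_limit_le:
  fixes A :: "real ^ 'n ^ 'm" and v v' :: "real ^ 'n"
  assumes A: "preserves_chebyshev A" and v: "v \<in> Ch" and v': "v' \<in> Ch"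
    and sgn: "sign_vec v = sign_vec v'"
  shows "am_limit A v \<le> am_limit A v'"
proof -
  define c where "c k = infnorm (phi A (am_v A v k))" for k
  define z where "z k = c k *\<^sub>R am_v A v (Suc k)" for k
  have u: "phi A (am_v A v k) \<in> Ch" and w: "am_v A v k \<in> Ch" for k
    using A v by (auto intro: phi_Ch am_v_Ch)
  have c: "c k > 0" for k
  proof -
    have "phi A (am_v A v k) \<noteq> 0" using u[of k] by (auto simp: Ch_def)
    then show ?thesis by (simp add: c_def infnorm_pos_lt)
  qed
  obtain d C where "d > 0" and bnd: "\<forall>x\<in>Ch. phi (transpose A) x \<in> Ch \<longrightarrow>
      (\<forall>j. d \<le> \<bar>phi (transpose A) x $ j\<bar> * infnorm x \<and> \<bar>phi (transpose A) x $ j\<bar> * infnorm x \<le> C)"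
    using phi_bounds[of "transpose A"] by blast
  let ?B = "{x :: real ^ 'n. \<forall>j. d \<le> \<bar>x $ j\<bar> \<and> \<bar>x $ j\<bar> \<le> C}"
  have "z k \<in> ?B" for k
  proof -
    have "phi (transpose A) (phi A (am_v A v k)) \<in> Ch"
      using w[of "Suc k"] by (simp add: psi_eq_phi_transpose)
    with bnd u[of k] c[of k] show ?thesis
      by (simp add: z_def c_def psi_eq_phi_transpose abs_mult mult.commute)
  qed
  then have zB: "\<forall>k. z k \<in> ?B" by blast
  obtain l r where l: "l \<in> ?B" and r: "strict_mono r" and lim: "(z \<circ> r) \<longlonglongrightarrow> l"
    by (rule seq_compactE[OF compact_imp_seq_compact[OF compact_box_off_axes[of d C]] zB])
  have lCh: "l \<in> Ch" unfolding Ch_def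
  proof (intro CollectI allI)
    fix j
    have "d \<le> \<bar>l $ j\<bar>" using l by blast
    with \<open>d > 0\<close> show "l $ j \<noteq> 0" by auto
  qed
  have zCh: "z k \<in> Ch" for k using c[of k] w[of "Suc k"] by (auto simp: z_def Ch_def)
  have shift: "am_v A (z k) N = c k *\<^sub>R am_v A v (Suc k + N)" for k N
    unfolding z_def by (simp add: am_v_scale[OF A w c] am_v_add del: am_v.simps)
  have sub: "filterlim (\<lambda>k. Suc (r k) + N) sequentially sequentially" for N
    by (rule filterlim_subseq) (use r in \<open>auto simp: strict_mono_def\<close>)
  have E: "am_error A (am_v A l N) = am_limit A v" for N
  proof -
    have "continuous_on Ch (\<lambda>x. am_error A (am_v A x N))"
      by (rule continuous_on_compose2[OF continuous_on_am_error[OF A] continuous_on_am_v[OF A]])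
         (use A am_v_Ch in blast)
    then have "(\<lambda>k. am_error A (am_v A ((z \<circ> r) k) N)) \<longlonglongrightarrow> am_error A (am_v A l N)"
      by (rule continuous_on_tendsto_compose[OF _ lim lCh]) (simp add: zCh)
    moreover have "am_error A (am_v A ((z \<circ> r) k) N) = am_error A (am_v A v (Suc (r k) + N))" for k
      by (simp add: shift am_error_scale[OF A w c] del: am_v.simps add_Suc)
    ultimately have "(\<lambda>k. am_error A (am_v A v (Suc (r k) + N))) \<longlonglongrightarrow> am_error A (am_v A l N)"
      by simp
    then show ?thesis
      using filterlim_compose[OF am_error_LIMSEQ[OF A v] sub] LIMSEQ_unique by blast
  qed
  obtain N where N: "\<And>u' v'. u' \<in> Ch \<Longrightarrow> v' \<in> Ch \<Longrightarrow> sign_vec u' = sign_vec (phi A (am_v A l N)) \<Longrightarrow>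
       sign_vec v' = sign_vec (am_v A l (Suc N)) \<Longrightarrow> am_limit A v \<le> cheb_norm (A - outer u' v')"
    using constant_error_lower_bound[OF A lCh E] by blast
  have "eventually (\<lambda>k. am_limit A v \<le> am_error A (am_v A v' (Suc (r k) + N))) sequentially"
    using eventually_sign_vec_eq[OF lim lCh]
  proof (rule eventually_mono)
    fix k
    assume "sign_vec ((z \<circ> r) k) = sign_vec l"
    then have eq: "sign_vec (z (r k)) = sign_vec l" by simp
    let ?x = "am_v A v' (Suc (r k) + N)"
    have x: "?x \<in> Ch" using A v' by (rule am_v_Ch)
    have "sign_vec ?x = sign_vec (am_v A v (Suc (r k) + N))"
      by (rule sign_vec_am_v_cong[OF A v' v sgn[symmetric]])
    also have "\<dots> = sign_vec (am_v A (z (r k)) N)"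
      by (simp add: shift sign_vec_scale c del: am_v.simps add_Suc)
    also have "\<dots> = sign_vec (am_v A l N)"
      by (rule sign_vec_am_v_cong[OF A zCh lCh eq])
    finally have s: "sign_vec ?x = sign_vec (am_v A l N)" .
    have lN: "am_v A l N \<in> Ch" using A lCh by (rule am_v_Ch)
    have "sign_vec (phi A ?x) = sign_vec (phi A (am_v A l N))"
      by (rule sign_vec_phi_cong[OF x lN s])
    moreover have "sign_vec (psi A (phi A ?x)) = sign_vec (am_v A l (Suc N))"
      using sign_vec_am_v_cong[OF A x lN s, of 1] by simp
    ultimately show "am_limit A v \<le> am_error A ?x"
      unfolding am_error_def by (intro N phi_Ch psi_Ch A x)
  qed
  then show ?thesis
    by (rule tendsto_lowerbound[OF filterlim_compose[OF am_error_LIMSEQ[OF A v'] sub]]) simp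
qed

theorem theorem5p1:
  fixes A :: "real ^ 'n ^ 'm" and v v' :: "real ^ 'n"
  assumes "CARD('m) \<ge> 2" and "CARD('n) \<ge> 2"
    and "preserves_chebyshev A"
    and "v \<in> Ch" and "v' \<in> Ch"
    and "sign_vec v = sign_vec v'"
  shows "am_limit A v = am_limit A v'"
  using am_limit_le[OF assms(3-6)] am_limit_le[OF assms(3,5,4) assms(6)[symmetric]]
  by (rule antisym)

end
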